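(* Let $c_0$ be a $2$-colouring of the four points of $\mathrm{PG}(1,3)$ in which exactly two points receive each colour. If $n\ge 2$ and $c$ is a $c_0$-free $2$-colouring of $G=\mathrm{PG}(n-1,3)$, then $G$ has a monochromatic subspace of dimension at least $\lceil n/2\rceil$. Moreover, this is best possible: for every $n\ge2$ there is a $c_0$-free $2$-colouring of $\mathrm{PG}(n-1,3)$ with no monochromatic subspace of dimension greater than $\lceil n/2\rceil$.
   Context: $\mathrm{PG}(n-1,3)$ has as points the one-dimensional subspaces of $\mathbb F_3^n$; a subspace of it consists of the points contained in a linear subspace of $\mathbb F_3^n$, of the same dimension. For colourings $c$ of $\mathrm{PG}(n-1,3)$ and $c_0$ of $\mathrm{PG}(1,3)$, $c$ contains $c_0$ if there is an injective linear map $\psi:\mathbb F_3^2\to\mathbb F_3^n$ such that for each point $x$ of $\mathrm{PG}(1,3)$ the colour under $c$ of the point $\psi(x)$ equals $c_0(x)$; $c$ is $c_0$-free if it does not contain $c_0$. A set is monochromatic if all its points have the same colour. *)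

theory Defs
  imports "HOL-Analysis.Analysis"
begin

text \<open>
  The points of the projective geometry on \<open>'f ^ 'n\<close> are the one-dimensional linear subspaces.
  With \<open>CARD('f) = 3\<close> and \<open>CARD('n) = n\<close> this is $PG(n-1,3)$.
\<close>

definition pg_points :: "('f::field ^ 'n::finite) set set" where
  "pg_points = {X. vec.subspace X \<and> vec.dim X = 1}"

text \<open>
  The dimension of a projective subspace is the linear one: a point has dimension 1, the whole of
  $PG(n-1,3)$ has dimension $n$, and the empty set is the subspace of dimension 0.
\<close>

definition pg_subspace :: "('f::field ^ 'n::finite) set set \<Rightarrow> nat \<Rightarrow> bool" where
  "pg_subspace S d \<longleftrightarrow>
     (\<exists>W. vec.subspace W \<and> vec.dim W = d \<and> S = {X \<in> pg_points. X \<subseteq> W})"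

text \<open>
  A 2-colouring is a function from sets of vectors to \<open>bool\<close>; only its values on
  \<open>pg_points\<close> are ever used.
\<close>

definition monochromatic :: "(('f::field ^ 'n::finite) set \<Rightarrow> bool) \<Rightarrow> ('f ^ 'n) set set \<Rightarrow> bool" where
  "monochromatic c S \<longleftrightarrow> (\<exists>b. \<forall>X\<in>S. c X = b)"

definition pg_contains ::
  "(('f::field ^ 'n::finite) set \<Rightarrow> bool) \<Rightarrow> (('f ^ 2) set \<Rightarrow> bool) \<Rightarrow> bool" where
  "pg_contains c c0 \<longleftrightarrow>
     (\<exists>\<psi> :: 'f ^ 2 \<Rightarrow> 'f ^ 'n.
        Vector_Spaces.linear (*s) (*s) \<psi> \<and> inj \<psi> \<and> (\<forall>X\<in>pg_points. c (\<psi> ` X) = c0 X))"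

abbreviation pg_free ::
  "(('f::field ^ 'n::finite) set \<Rightarrow> bool) \<Rightarrow> (('f ^ 2) set \<Rightarrow> bool) \<Rightarrow> bool" where
  "pg_free c c0 \<equiv> \<not> pg_contains c c0"

end

theory Submission
  imports Defs
begin

text \<open>
  Colour the nonzero vectors \<open>x\<close> by \<open>P x = c (span {x})\<close>. Any two 2-2 colourings of the four points of a line
  are equivalent under linear maps, so \<open>c\<close> is \<open>c0\<close>-free iff no line is split 2-2.

  Every nonzero subspace \<open>U\<close> has a proper subspace \<open>H\<close> with \<open>P\<close> constant on \<open>U - H\<close>. If some colour class
  does not span \<open>U\<close>, its span is \<open>H\<close>. Otherwise take hyperplanes \<open>H1\<close>, \<open>H2\<close> spanned by vectors of the
  first and of the second colour; by induction \<open>H1 - K1\<close> and \<open>H2 - K2\<close> have these colours for some proper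
  subspaces \<open>K1\<close>, \<open>K2\<close>. Then \<open>H1 \<inter> H2\<close> lies in one of them, and the lines joining \<open>H1\<close> to \<open>H2\<close> show that
  \<open>U - H1\<close> or \<open>U - H2\<close> is constant. Adding a vector of \<open>U - H\<close> to a monochromatic subspace of the right colour
  in a hyperplane, one gets by induction two monochromatic subspaces, one of each colour, whose dimensions add up to \<open>n\<close>.

  For sharpness, colour a point by the parity of the position of the first nonzero coordinate of its vectors.
  A monochromatic subspace then embeds into the coordinates of one parity.
\<close>

section \<open>Arithmetic over the field with three elements\<close>

text \<open>If \<open>1 = -1\<close>, any \<open>a\<close> outside \<open>{0, 1}\<close> would give
  four distinct elements \<open>0\<close>, \<open>1\<close>, \<open>a\<close>,
  \<open>a + 1\<close>.\<close>

lemma card_three_field: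
  assumes "CARD('f::field) = 3"
  shows "(UNIV :: 'f set) = {0, 1, -1}" and "(1::'f) \<noteq> -1"
proof -
  have fin: "finite (UNIV :: 'f set)"
    using assms card.infinite by fastforce
  show ne: "(1::'f) \<noteq> -1"
  proof
    assume e: "(1::'f) = -1"
    have "card {0, 1::'f} < CARD('f)"
      using assms by simp
    then have "(UNIV :: 'f set) \<noteq> {0, 1}"
      by (metis less_irrefl)
    then obtain a :: 'f where a: "a \<noteq> 0" "a \<noteq> 1"
      by blast
    have "a + 1 \<noteq> 0"
      using a(2) e eq_neg_iff_add_eq_0 by metis
    then have "card {0, 1, a, a + 1} = 4"
      using a by auto
    moreover have "card {0, 1, a, a + 1} \<le> CARD('f)"
      using fin by (intro card_mono) auto
    ultimately show False
      using assms by simp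
  qed
  have "card {0, 1, -1::'f} = 3"
    using ne by simp
  then show "(UNIV :: 'f set) = {0, 1, -1}"
    using fin assms by (metis card_subset_eq subset_UNIV)
qed

lemma card_three_cases:
  assumes "CARD('f::field) = 3"
  obtains "(a::'f) = 0" | "a = 1" | "a = -1"
  using card_three_field(1)[OF assms] by (metis UNIV_I insertE singletonD)

lemma card_three_add_self:
  assumes "CARD('f::field) = 3"
  shows "(a::'f) + a = -a"
proof -
  have "(1::'f) + 1 = -1"
    using card_three_field(2)[OF assms] card_three_cases[OF assms, of "1 + 1"]
    by (metis add_cancel_left_left eq_neg_iff_add_eq_0 zero_neq_one)
  moreover have "a + a = a * (1 + 1)"
    by (simp only: distrib_left mult_1_right)
  ultimately show ?thesis
    by simp
qed

lemma card_three_vec_add_self: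
  fixes x :: "'f::field ^ 'n::finite"
  assumes "CARD('f) = 3"
  shows "x + x = -x"
  unfolding vec_eq_iff vector_add_component vector_uminus_component
  using card_three_add_self[OF assms] by blast

lemma card_three_span_singleton:
  fixes x :: "'f::field ^ 'n::finite"
  assumes "CARD('f) = 3"
  shows "vec.span {x} = {0, x, -x}"
proof -
  have "k *s x \<in> {0, x, -x}" for k :: 'f
    by (cases k rule: card_three_cases[OF assms]) auto
  moreover have "0 = 0 *s x" "x = 1 *s x" "-x = (-1) *s x"
    by auto
  ultimately show ?thesis
    unfolding vec.span_singleton by blast
qed

section \<open>Colourings in which no line is split 2-2\<close>

text \<open>
  Condition on \<open>P\<close> for the line through \<open>x\<close> and \<open>y\<close>, whose points are spanned by \<open>x\<close>, \<open>y\<close>, \<open>x + y\<close> and \<open>x - y\<close>.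
\<close>

definition unsplit :: "('f::field ^ 'n::finite \<Rightarrow> bool) \<Rightarrow> bool" where
  "unsplit P \<longleftrightarrow> (\<forall>x. P (-x) = P x) \<and>
     (\<forall>x y. x \<noteq> 0 \<longrightarrow> y \<noteq> 0 \<longrightarrow> x \<noteq> y \<longrightarrow> x \<noteq> -y \<longrightarrow> P x = P y \<longrightarrow>
        P (x + y) = P (x - y) \<longrightarrow> P (x + y) = P x)"

lemma unsplit_minus: "unsplit P \<Longrightarrow> P (-x) = P x"
  unfolding unsplit_def by blast

lemma unsplit_minus_diff: "unsplit P \<Longrightarrow> P (x - y) = P (y - x)"
  using unsplit_minus[of P "x - y"] by simp

lemma unsplit_same:
  assumes "unsplit P" "x \<noteq> 0" "y \<noteq> 0" "x \<noteq> y" "x \<noteq> -y" "P x = P y" "P (x + y) = P (x - y)"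
  shows "P (x + y) = P x"
  using assms unfolding unsplit_def by blast

text \<open>The definition of \<open>unsplit\<close> only forbids the pairing of \<open>x\<close>,
  \<open>y\<close> against \<open>x + y\<close>, \<open>x - y\<close>. The other two pairings are
  the same condition for another basis of the line: \<open>x + y\<close> together with whichever of
  \<open>x\<close>, \<open>y\<close> shares its colour.\<close>

lemma unsplit_diff:
  fixes x y :: "'f::field ^ 'n::finite"
  assumes F: "CARD('f) = 3" and P: "unsplit P" and nz: "x \<noteq> 0" "y \<noteq> 0" and ne: "P x \<noteq> P y"
  shows "P (x + y) = P (x - y)"
proof (rule ccontr)
  assume d: "P (x + y) \<noteq> P (x - y)"
  note double = card_three_vec_add_self[OF F]
  have xy: "x \<noteq> y" "x \<noteq> -y" "x + y \<noteq> 0" "x + y \<noteq> x" "x + y \<noteq> y"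
    using ne unsplit_minus[OF P] nz by (auto simp: add_eq_0_iff2)
  have m: "x \<noteq> -(x + y)" "y \<noteq> -(x + y)"
  proof -
    show "x \<noteq> -(x + y)"
    proof
      assume "x = -(x + y)"
      then have "y = -(x + x)" by (metis add.assoc add_eq_0_iff add.commute add.inverse_inverse)
      then show False using double[of x] xy by auto
    qed
    show "y \<noteq> -(x + y)"
    proof
      assume "y = -(x + y)"
      then have "x = -(y + y)" by (metis add.assoc add_eq_0_iff add.commute add.inverse_inverse)
      then show False using double[of y] xy by auto
    qed
  qed
  show False
  proof (cases "P (x + y) = P x")
    case True
    \<comment> \<open>As \<open>x + x = -x\<close>, the other two points of the line, seen from the
      basis \<open>x\<close>, \<open>x + y\<close>, are spanned by \<open>y - x\<close> and
      \<open>-y\<close>.\<close>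
    have "x + (x + y) = y - x"
      using double[of x] by (metis add.assoc add.commute diff_conv_add_uminus)
    moreover have "x - (x + y) = -y" by simp
    ultimately have "P (y - x) = P x"
      using unsplit_same[OF P nz(1) xy(3)] xy m True d ne unsplit_minus[OF P] unsplit_minus_diff[OF P, of x y]
      by metis
    then show False
      using True d unsplit_minus_diff[OF P, of x y] by simp
  next
    case False
    have "y + (x + y) = x - y"
      using double[of y] by (metis add.assoc add.commute diff_conv_add_uminus)
    moreover have "y - (x + y) = -x" by simp
    ultimately have "P (x - y) = P y"
      using unsplit_same[OF P nz(2) xy(3)] xy m False d ne unsplit_minus[OF P]
      by metis
    then show False
      using False d ne by simp
  qed
qed

section \<open>Hyperplanes of a subspace\<close>

text \<open>Over the field with three elements, the last clause says that \<open>H\<close> has codimension 1 in \<open>U\<close>.\<close>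

definition hyperplane_in :: "('f::field ^ 'n::finite) set \<Rightarrow> ('f ^ 'n) set \<Rightarrow> bool" where
  "hyperplane_in H U \<longleftrightarrow> vec.subspace H \<and> H \<subset> U \<and> (\<forall>x\<in>U - H. \<forall>v\<in>U - H. v - x \<in> H \<or> v + x \<in> H)"

text \<open>A vector of the span outside \<open>vec.span (B - {b})\<close> has coefficient
  \<open>1\<close> or \<open>-1\<close> at \<open>b\<close>, so the sum or the difference of two
  such vectors loses its \<open>b\<close>-part.\<close>

lemma hyperplane_of_basis:
  fixes B :: "('f::field ^ 'n::finite) set"
  assumes F: "CARD('f) = 3" and B: "vec.independent B" and b: "b \<in> B"
  shows "hyperplane_in (vec.span (B - {b})) (vec.span B)"
    and "vec.dim (vec.span B) = Suc (vec.dim (vec.span (B - {b})))"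
proof -
  let ?H = "vec.span (B - {b})"
  have fin: "finite B" using B by (rule vec.finiteI_independent)
  have "vec.independent (B - {b})" using B vec.independent_mono by blast
  then show "vec.dim (vec.span B) = Suc (vec.dim ?H)"
    using B card.remove[OF fin b] by (simp add: vec.dim_eq_card_independent)
  have bH: "b \<notin> ?H" using B b vec.dependent_def by blast
  have sub: "?H \<subset> vec.span B"
    using bH b vec.span_base vec.span_mono[of "B - {b}" B] by blast
  have dec: "x - b \<in> ?H \<or> x + b \<in> ?H" if x: "x \<in> vec.span B - ?H" for x
  proof -
    obtain k where k: "x - k *s b \<in> ?H"
      using vec.span_breakdown[OF b, of x] x by blast
    show ?thesis
      by (cases k rule: card_three_cases[OF F]) (use k x in auto)
  qed
  have "v - x \<in> ?H \<or> v + x \<in> ?H" if "x \<in> vec.span B - ?H" "v \<in> vec.span B - ?H" for x v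
  proof -
    have "v - x = (v - b) - (x - b)" "v - x = (v + b) - (x + b)"
      "v + x = (v - b) + (x + b)" "v + x = (v + b) + (x - b)"
      by auto
    then show ?thesis
      using dec[OF that(1)] dec[OF that(2)] vec.span_add vec.span_diff by metis
  qed
  then show "hyperplane_in ?H (vec.span B)"
    unfolding hyperplane_in_def using sub vec.subspace_span by blast
qed

lemma subspace_subset_Un:
  assumes "vec.subspace A" "vec.subspace B" "vec.subspace C" "A \<subseteq> B \<union> C"
  shows "A \<subseteq> B \<or> A \<subseteq> (C :: ('f::field ^ 'n::finite) set)"
proof (rule ccontr)
  assume "\<not> ?thesis"
  then obtain x y where xy: "x \<in> A" "x \<notin> B" "y \<in> A" "y \<notin> C" by blast
  then have "y \<in> B" "x \<in> C" using assms(4) by blast+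
  moreover have "x + y \<in> B \<or> x + y \<in> C"
    using xy assms(1,4) vec.subspace_add by blast
  moreover have "x = (x + y) - y" "y = (x + y) - x" by auto
  ultimately show False using xy assms vec.subspace_diff by metis
qed

text \<open>A basis of \<open>H\<close> extends to a basis of \<open>U\<close>; dropping one of the
  new vectors leaves a basis of \<open>H'\<close>.\<close>

lemma hyperplane_ext:
  fixes H :: "('f::field ^ 'n::finite) set"
  assumes F: "CARD('f) = 3" and H: "vec.subspace H" "H \<subset> U" "vec.subspace U"
  obtains H' where "H \<subseteq> H'" "hyperplane_in H' U" "vec.dim U = Suc (vec.dim H')"
proof -
  obtain B where B: "B \<subseteq> H" "vec.independent B" "H \<subseteq> vec.span B"
    using vec.basis_exists by metis
  then obtain C where C: "B \<subseteq> C" "C \<subseteq> U" "vec.independent C" "U \<subseteq> vec.span C"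
    using vec.maximal_independent_subset_extend[of B U] H(2) by blast
  have U: "vec.span C = U" using C H(3) vec.span_minimal by blast
  have "B \<noteq> C" using U B(3) H(1,2) vec.span_minimal[OF B(1)] by blast
  then obtain b where b: "b \<in> C" "b \<notin> B" using C by blast
  have "vec.span B \<subseteq> vec.span (C - {b})"
    using b C by (intro vec.span_mono) auto
  then show thesis
    using that[of "vec.span (C - {b})"] hyperplane_of_basis[OF F C(3) b(1)] B U by auto
qed


section \<open>Constancy of the colour off a proper subspace\<close>

text \<open>All vectors outside both \<open>H1\<close> and \<open>H2\<close> turn out to have one
  common colour. If it is \<open>B\<close>, it agrees with the colour of \<open>H1 - H2\<close>, and
  \<open>U - H2\<close> is constant; otherwise it agrees with that of \<open>H2 - H1\<close>, and
  \<open>U - H1\<close> is constant.\<close>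

lemma unsplit_two_hyperplanes:
  fixes P :: "'f::field ^ 'n::finite \<Rightarrow> bool"
  assumes F: "CARD('f) = 3" and P: "unsplit P"
    and U: "vec.subspace U" and H1: "hyperplane_in H1 U" and H2: "hyperplane_in H2 U"
    and K1: "vec.subspace K1" "K1 \<subset> H1" "\<forall>x\<in>H1 - K1. P x = B"
    and K2: "vec.subspace K2" "K2 \<subset> H2" "\<forall>x\<in>H2 - K2. P x = (\<not> B)"
    and K: "H1 \<inter> H2 \<subseteq> K1"
  shows "\<exists>H. vec.subspace H \<and> H \<subset> U \<and> (\<exists>b. \<forall>x\<in>U - H. P x = b)"
proof -
  note sub = H1[unfolded hyperplane_in_def, THEN conjunct1] H2[unfolded hyperplane_in_def, THEN conjunct1]
  have HU: "H1 \<subset> U" "H2 \<subset> U" using H1 H2 by (auto simp: hyperplane_in_def)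
  have hyp1: "v - x \<in> H1 \<or> v + x \<in> H1" if "x \<in> U" "v \<in> U" "x \<notin> H1" "v \<notin> H1" for x v
    using H1 that by (auto simp: hyperplane_in_def)
  have hyp2: "v - x \<in> H2 \<or> v + x \<in> H2" if "x \<in> U" "v \<in> U" "x \<notin> H2" "v \<notin> H2" for x v
    using H2 that by (auto simp: hyperplane_in_def)
  have add_iff: "x + y \<in> W \<longleftrightarrow> y \<in> W" "x - y \<in> W \<longleftrightarrow> y \<in> W"
    "y + x \<in> W \<longleftrightarrow> y \<in> W" "y - x \<in> W \<longleftrightarrow> y \<in> W" if W: "vec.subspace W" and x: "x \<in> W" for W and x y :: "'f ^ 'n"
  proof -
    have "y = (x + y) - x" "y = x - (x - y)" "y = (y - x) + x" by auto
    then show "x + y \<in> W \<longleftrightarrow> y \<in> W" "x - y \<in> W \<longleftrightarrow> y \<in> W" "y + x \<in> W \<longleftrightarrow> y \<in> W" "y - x \<in> W \<longleftrightarrow> y \<in> W"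
      using vec.subspace_add[OF W] vec.subspace_diff[OF W] x add.commute by metis+
  qed
  have neg_iff: "-x \<in> W \<longleftrightarrow> x \<in> W" if "vec.subspace W" for W and x :: "'f ^ 'n"
    using vec.subspace_neg[OF that] by (metis add.inverse_inverse)
  have zero: "0 \<in> W" if "vec.subspace W" for W :: "('f ^ 'n) set"
    using that by (rule vec.subspace_0)
  have PH1: "P x = B" if x: "x \<in> H1" "x \<notin> H2" for x
  proof -
    have "x \<notin> K1"
    proof
      assume xK: "x \<in> K1"
      \<comment> \<open>Since \<open>H1 \<inter> H2\<close> lies in \<open>K1\<close>, this
        \<open>v\<close> is outside \<open>H2\<close> like \<open>x\<close>; hence
        \<open>v - x\<close> or \<open>v + x\<close> falls into \<open>H1 \<inter> H2\<close>, and
        \<open>v\<close> would be in \<open>K1\<close> after all.\<close>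
      obtain v where v: "v \<in> H1" "v \<notin> K1" using K1 by blast
      then have "v - x \<in> H2 \<or> v + x \<in> H2" using hyp2[of x v] x HU K by blast
      then have "v - x \<in> K1 \<or> v + x \<in> K1"
        using K v(1) x(1) vec.subspace_add[OF sub(1)] vec.subspace_diff[OF sub(1)] by blast
      then show False using v(2) add_iff[OF K1(1) xK] by blast
    qed
    then show ?thesis using K1(3) x by blast
  qed
  obtain h where h: "h \<in> H1" "h \<notin> H2" using K K1(2) by blast
  have "\<not> H2 \<subseteq> H1"
  proof
    assume s: "H2 \<subseteq> H1"
    obtain z where z: "z \<in> U" "z \<notin> H1" using HU by blast
    then have "z - h \<in> H1 \<or> z + h \<in> H1" using hyp2[of h z] h HU s by blast
    then show False using z(2) add_iff[OF sub(1) h(1)] by blast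
  qed
  then have "\<not> H2 \<subseteq> H1 \<union> K2"
    using subspace_subset_Un[OF sub(2,1) K2(1)] K2(2) by blast
  \<comment> \<open>With \<open>h\<close> of colour \<open>B\<close> and \<open>b\<close> of the
    other colour, every vector outside \<open>H1\<close> and \<open>H2\<close> is, up to sign,
    \<open>h + b\<close> or \<open>h - b\<close> plus an element of
    \<open>H1 \<inter> H2\<close>.\<close>
  then obtain b where b: "b \<in> H2" "b \<notin> H1" "b \<notin> K2" by blast
  have hbU: "h \<in> U" "b \<in> U" using h b HU by auto
  have dec0: "\<exists>k\<in>H1 \<inter> H2. v = h + b + k \<or> v = h - b + k"
    if v: "v \<in> U" "v \<notin> H1" "v - h \<in> H2" for v
  proof -
    have w: "v - h \<notin> H1" using v(2) add_iff[OF sub(1) h(1)] by blast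
    then have "v - h - b \<in> H1 \<or> v - h + b \<in> H1"
      using hyp1[of b "v - h"] b hbU v(3) HU by blast
    moreover have "v - h - b \<in> H2" "v - h + b \<in> H2"
      using add_iff[OF sub(2) b(1)] v(3) by blast+
    moreover have "v = h + b + (v - h - b)" "v = h - b + (v - h + b)" by auto
    ultimately show ?thesis by blast
  qed
  have dec: "\<exists>k\<in>H1 \<inter> H2. P v = P (h + b + k) \<or> P v = P (h - b + k)"
    if v: "v \<in> U" "v \<notin> H1" "v \<notin> H2" for v
  proof (cases "v - h \<in> H2")
    case True
    then show ?thesis using dec0[OF v(1,2)] by blast
  next
    case False
    then have "v + h \<in> H2" using hyp2[of h v] v h hbU by blast
    then have "-v - h \<in> H2" using neg_iff[OF sub(2), of "v + h"] by simp
    then have "\<exists>k\<in>H1 \<inter> H2. -v = h + b + k \<or> -v = h - b + k"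
      using dec0[of "-v"] v neg_iff sub U by blast
    then show ?thesis using unsplit_minus[OF P, of v] by metis
  qed
  \<comment> \<open>The two vectors are \<open>x + y\<close> and \<open>x - y\<close> for some \<open>x \<in> H1 - H2\<close> and \<open>y \<in> H2 - K2\<close> of different colours.\<close>
  have link: "P (h + b + k) = P (h - b + m)"
    if k: "k \<in> H1 \<inter> H2" and m: "m \<in> H1 \<inter> H2" and nK: "b + (m - k) \<notin> K2" for k m
  proof -
    let ?x = "h - (k + m)" and ?y = "b + (m - k)"
    have km: "k + m \<in> H1 \<inter> H2" "m - k \<in> H1 \<inter> H2"
      using k m sub vec.subspace_add vec.subspace_diff by blast+
    have x: "?x \<in> H1" "?x \<notin> H2"
      using h km add_iff(4)[OF sub(1), of "k + m" h] add_iff(4)[OF sub(2), of "k + m" h] by auto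
    have y: "?y \<in> H2" "?y \<notin> H1"
      using b km add_iff(3)[OF sub(1), of "m - k" b] add_iff(3)[OF sub(2), of "m - k" b] by auto
    have "?x \<noteq> 0" "?y \<noteq> 0" using x(2) y(2) zero[OF sub(1)] zero[OF sub(2)] by auto
    moreover have "P ?x \<noteq> P ?y" using PH1[OF x] K2(3) y nK by blast
    ultimately have "P (?x + ?y) = P (?x - ?y)"
      using unsplit_diff[OF F P] by blast
    moreover have "?x + ?y = h + b + - (k + k)" "?x - ?y = h - b + - (m + m)" by auto
    ultimately show ?thesis
      by (simp only: card_three_vec_add_self[OF F] add.inverse_inverse)
  qed
  have same: "P (h - b + k) = P (h + b + k)" if "k \<in> H1 \<inter> H2" for k
    using link[OF that that] b by simp
  have "P (h + b + k) = P (h + b + m)" if k: "k \<in> H1 \<inter> H2" and m: "m \<in> H1 \<inter> H2" for k m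
  proof -
    \<comment> \<open>The two vectors add up to \<open>b + b = -b\<close>, which is outside
      \<open>K2\<close>. So \<open>link\<close> applies to \<open>k\<close> and \<open>m\<close> in
      at least one order, and \<open>same\<close> then changes the sign of \<open>b\<close>.\<close>
    have "b + (m - k) \<notin> K2 \<or> b + (k - m) \<notin> K2"
    proof (rule ccontr)
      assume "\<not> ?thesis"
      then have "(b + (m - k)) + (b + (k - m)) \<in> K2" using vec.subspace_add[OF K2(1)] by blast
      moreover have "(b + (m - k)) + (b + (k - m)) = b + b" by simp
      ultimately show False
        using card_three_vec_add_self[OF F, of b] neg_iff[OF K2(1)] b(3) by simp
    qed
    then show ?thesis using link same k m by metis
  qed
  then have T: "P v = P (h + b)" if "v \<in> U" "v \<notin> H1" "v \<notin> H2" for v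
    using dec[OF that] same zero sub by (metis Int_iff add.right_neutral)
  show ?thesis
  proof (cases "P (h + b) = B")
    case True
    then have "\<forall>x\<in>U - H2. P x = B" using T PH1 by blast
    then show ?thesis using sub HU by blast
  next
    case False
    have "P x = P (h + b)" if x: "x \<in> U" "x \<notin> H1" for x
    proof (cases "x \<in> H2")
      case True
      \<comment> \<open>Here \<open>x\<close> may lie in \<open>K2\<close>, where nothing is assumed
        about its colour. If it were \<open>B\<close>, the line through \<open>h\<close> and
        \<open>x\<close> would be split 2-2, because \<open>h + x\<close> and \<open>h - x\<close>
        avoid both hyperplanes and have the other colour.\<close>
      have "P x \<noteq> B"
      proof
        assume Px: "P x = B"
        have hx: "h + x \<in> U" "h - x \<in> U"
          using U hbU x(1) vec.subspace_add vec.subspace_diff by blast+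
        have "h + x \<notin> H1" "h - x \<notin> H1" "h + x \<notin> H2" "h - x \<notin> H2"
          using h x True add_iff[OF sub(1) h(1), of x] add_iff[OF sub(2) True, of h] by auto
        then have "P (h + x) = P (h + b)" "P (h - x) = P (h + b)"
          using T hx by blast+
        moreover have "h \<noteq> 0" "x \<noteq> 0" "h \<noteq> x" "h \<noteq> -x"
          using h x True zero[OF sub(1)] zero[OF sub(2)] neg_iff[OF sub(2), of x] by auto
        ultimately show False
          using unsplit_same[OF P, of h x] Px PH1[OF h] False by simp
      qed
      then show ?thesis using False by blast
    qed (use T x in blast)
    then show ?thesis using sub HU by blast
  qed
qed

text \<open>Choosing the basis inside \<open>S\<close> keeps the generators of the hyperplane in
  \<open>S\<close>; with \<open>S\<close> a colour class, they all have the same colour.\<close>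

lemma hyperplane_spanned:
  fixes S :: "('f::field ^ 'n::finite) set"
  assumes F: "CARD('f) = 3" and S: "vec.span S = U" "U \<noteq> {0}"
  obtains S' where "S' \<subseteq> S" "hyperplane_in (vec.span S') U"
proof -
  obtain B where B: "B \<subseteq> S" "vec.independent B" "S \<subseteq> vec.span B"
    using vec.maximal_independent_subset by metis
  have U: "vec.span B = U"
    using B S(1) by (metis vec.span_eq vec.span_superset subset_trans)
  then obtain b where "b \<in> B" using S(2) by fastforce
  then show thesis
    using that[of "B - {b}"] hyperplane_of_basis[OF F B(2)] B(1) U by blast
qed

lemma unsplit_constant_off_subspace:
  fixes P :: "'f::field ^ 'n::finite \<Rightarrow> bool"
  assumes F: "CARD('f) = 3" and P: "unsplit P"
    and U: "vec.subspace U" "U \<noteq> {0}"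
  shows "\<exists>H. vec.subspace H \<and> H \<subset> U \<and> (\<exists>b. \<forall>x\<in>U - H. P x = b)"
  using U
proof (induction "vec.dim U" arbitrary: U rule: less_induct)
  case less
  let ?S = "\<lambda>b. {x \<in> U. P x = b}"
  show ?case
  proof (cases "\<exists>b. vec.span (?S b) \<noteq> U")
    case True
    then obtain b where b: "vec.span (?S b) \<noteq> U" by blast
    have "vec.span (?S b) \<subseteq> U"
      using less.prems(1) by (intro vec.span_minimal) auto
    moreover have "\<forall>x\<in>U - vec.span (?S b). P x = (\<not> b)"
      using vec.span_superset[of "?S b"] by blast
    ultimately show ?thesis using b vec.subspace_span by blast
  next
    case False
    have step: "\<exists>H K. hyperplane_in H U \<and> vec.subspace K \<and> K \<subset> H \<and> (\<forall>x\<in>H - K. P x = b)" for b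
    proof -
      obtain S' where S': "S' \<subseteq> ?S b" "hyperplane_in (vec.span S') U"
        using hyperplane_spanned[OF F _ less.prems(2), of "?S b"] False by blast
      let ?H = "vec.span S'"
      have "?H \<noteq> {0}"
      proof
        \<comment> \<open>Then the nonzero vectors of \<open>U\<close> are a single pair
          \<open>x\<close>, \<open>-x\<close> of equal colour, although each colour class spans
          \<open>U\<close> and so has a nonzero member.\<close>
        assume H0: "?H = {0}"
        have one: "y = x \<or> y = -x" if "x \<in> U - {0}" "y \<in> U" "y \<noteq> 0" for x y
        proof -
          have "y - x \<in> {0} \<or> y + x \<in> {0}"
            using S'(2) that unfolding hyperplane_in_def H0 by blast
          then show ?thesis by (simp add: eq_neg_iff_add_eq_0)
        qed
        have ex: "\<exists>x\<in>?S c. x \<noteq> 0" for c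
        proof (rule ccontr)
          assume "\<not> ?thesis"
          then have "vec.span (?S c) \<subseteq> vec.span {0}" by (intro vec.span_mono) auto
          then have "U \<subseteq> {0}" using False by simp
          then show False using less.prems vec.subspace_0 by blast
        qed
        obtain x where "x \<in> ?S True" "x \<noteq> 0" using ex[of True] by blast
        moreover obtain y where "y \<in> ?S False" "y \<noteq> 0" using ex[of False] by blast
        ultimately show False using one[of x y] unsplit_minus[OF P, of x] by blast
      qed
      moreover have "vec.span U = U"
        using less.prems(1) vec.span_eq_iff by blast
      then have "?H \<subset> vec.span U"
        using S'(2) unfolding hyperplane_in_def by metis
      then have "vec.dim ?H < vec.dim U"
        using vec.dim_psubset[of S' U] by simp
      ultimately obtain K d where K: "vec.subspace K" "K \<subset> ?H" "\<forall>x\<in>?H - K. P x = d"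
        using less.hyps[OF _ vec.subspace_span, of S'] by blast
      \<comment> \<open>Some generator, of colour \<open>b\<close>, lies outside \<open>K\<close>,
        which identifies the constant colour off \<open>K\<close>.\<close>
      have "\<not> S' \<subseteq> K" using K vec.span_minimal by blast
      then have "d = b" using S'(1) K(3) vec.span_superset[of S'] by blast
      then show ?thesis using S'(2) K by blast
    qed
    obtain H1 K1 where 1: "hyperplane_in H1 U" "vec.subspace K1" "K1 \<subset> H1" "\<forall>x\<in>H1 - K1. P x = True"
      using step by metis
    obtain H2 K2 where 2: "hyperplane_in H2 U" "vec.subspace K2" "K2 \<subset> H2" "\<forall>x\<in>H2 - K2. P x = False"
      using step by metis
    \<comment> \<open>A common vector outside both \<open>K1\<close> and \<open>K2\<close> would
      have both colours.\<close>
    have "H1 \<inter> H2 \<subseteq> K1 \<union> K2" using 1(4) 2(4) by blast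
    moreover have "vec.subspace (H1 \<inter> H2)"
      using 1(1) 2(1) vec.subspace_inter unfolding hyperplane_in_def by blast
    ultimately have "H1 \<inter> H2 \<subseteq> K1 \<or> H1 \<inter> H2 \<subseteq> K2"
      using subspace_subset_Un 1(2) 2(2) by blast
    then show ?thesis
    proof
      assume "H1 \<inter> H2 \<subseteq> K1"
      then show ?thesis
        using unsplit_two_hyperplanes[OF F P less.prems(1) 1(1) 2(1) 1(2-4) 2(2,3)] 2(4) by simp
    next
      assume "H1 \<inter> H2 \<subseteq> K2"
      then have "H2 \<inter> H1 \<subseteq> K2" by blast
      then show ?thesis
        using unsplit_two_hyperplanes[OF F P less.prems(1) 2(1) 1(1) 2(2-4) 1(2,3)] 1(4) by simp
    qed
  qed
qed

section \<open>Monochromatic subspaces of complementary dimensions\<close>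

text \<open>Both colours are tracked at once because the colour found off the hyperplane is not
  known in advance: whichever it is, one of the two subspaces grows by one dimension.\<close>

lemma unsplit_monochromatic_subspaces:
  fixes P :: "'f::field ^ 'n::finite \<Rightarrow> bool"
  assumes F: "CARD('f) = 3" and P: "unsplit P" and U: "vec.subspace U"
  shows "\<exists>W. (\<forall>b. vec.subspace (W b) \<and> (\<forall>x\<in>W b - {0}. P x = b) \<and> W b \<subseteq> U) \<and>
     vec.dim (W True) + vec.dim (W False) = vec.dim U"
  using U
proof (induction "vec.dim U" arbitrary: U rule: less_induct)
  case less
  show ?case
  proof (cases "U = {0}")
    case True
    then show ?thesis by (intro exI[of _ "\<lambda>_. {0}"]) auto
  next
    case False
    then obtain H0 b where H0: "vec.subspace H0" "H0 \<subset> U" "\<forall>x\<in>U - H0. P x = b"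
      using unsplit_constant_off_subspace[OF F P less.prems] by blast
    \<comment> \<open>\<open>H0\<close> may be smaller than a hyperplane; enlarging it keeps the
      colour constant outside and makes the dimension drop by exactly one.\<close>
    then obtain H where H: "H0 \<subseteq> H" "hyperplane_in H U" "vec.dim U = Suc (vec.dim H)"
      using hyperplane_ext[OF F _ _ less.prems] by metis
    then have Hs: "vec.subspace H" "H \<subset> U" by (auto simp: hyperplane_in_def)
    obtain W where W: "\<And>b. vec.subspace (W b)" "\<And>b x. x \<in> W b - {0} \<Longrightarrow> P x = b" "\<And>b. W b \<subseteq> H"
      "vec.dim (W True) + vec.dim (W False) = vec.dim H"
      using less.hyps[OF _ Hs(1)] H(3) by (metis lessI)
    obtain x where x: "x \<in> U" "x \<notin> H" using Hs by blast
    let ?V = "vec.span (insert x (W b))"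
    have V: "P v = b" if v: "v \<in> ?V - {0}" for v
    proof -
      obtain k where k: "v - k *s x \<in> W b"
        using vec.span_breakdown_eq[of v x "W b"] v vec.span_eq_iff W(1) by blast
      show ?thesis
      \<comment> \<open>Either \<open>v\<close> is already in \<open>W b\<close>, or its nonzero
        multiple of \<open>x\<close> takes it out of \<open>H\<close>, where the colour is
        \<open>b\<close>.\<close>
      proof (cases "k = 0")
        case True
        then show ?thesis using k v W(2)[of v b] by simp
      next
        case False
        have "v \<notin> H"
        proof
          assume "v \<in> H"
          moreover have "v - k *s x \<in> H" using k W(3) by blast
          ultimately have "v - (v - k *s x) \<in> H" using Hs(1) vec.subspace_diff by blast
          then have "k *s x \<in> H" by simp
          then have "inverse k *s (k *s x) \<in> H" using Hs(1) vec.subspace_scale by blast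
          then show False using x(2) False by simp
        qed
        moreover have "v \<in> U"
          using v vec.span_minimal[of "insert x (W b)" U] less.prems x(1) W(3)[of b] Hs(2) by blast
        ultimately show ?thesis using H0(3) H(1) by blast
      qed
    qed
    have "x \<notin> vec.span (W b)" using W(1,3) x(2) vec.span_eq_iff by blast
    then have "vec.dim ?V = Suc (vec.dim (W b))"
      using vec.dim_insert[of x "W b"] by simp
    moreover have "?V \<subseteq> U"
      using vec.span_minimal[of "insert x (W b)" U] less.prems x(1) W(3)[of b] Hs(2) by blast
    ultimately have dim: "vec.dim ((W(b := ?V)) True) + vec.dim ((W(b := ?V)) False) = vec.dim U"
      and "?V \<subseteq> U"
      using W(4) H(3) by (cases b; simp)+
    moreover have "vec.subspace ((W(b := ?V)) d) \<and> (\<forall>x\<in>(W(b := ?V)) d - {0}. P x = d) \<and> (W(b := ?V)) d \<subseteq> U" for d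
    proof (cases "d = b")
      case True
      then show ?thesis using V \<open>?V \<subseteq> U\<close> vec.subspace_span by simp
    next
      case False
      then show ?thesis using W(1)[of d] W(2)[of _ d] W(3)[of d] Hs(2) by auto
    qed
    ultimately show ?thesis by blast
  qed
qed

section \<open>Points and lines, and the translation of \<open>pg_free\<close> into
  \<open>unsplit\<close>\<close>

lemma pg_points_iff: "X \<in> pg_points \<longleftrightarrow> (\<exists>x. x \<noteq> 0 \<and> X = vec.span {x})"
proof
  assume X: "X \<in> pg_points"
  obtain B where B: "B \<subseteq> X" "vec.independent B" "X \<subseteq> vec.span B" "card B = vec.dim X"
    using vec.basis_exists by blast
  then obtain x where x: "B = {x}"
    using X card_1_singletonE unfolding pg_points_def by force
  have "x \<noteq> 0" using B(2) x by (auto simp: vec.dependent_single)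
  moreover have "X = vec.span {x}"
    using B(1,3) X x vec.span_minimal[of B X] unfolding pg_points_def by blast
  ultimately show "\<exists>x. x \<noteq> 0 \<and> X = vec.span {x}" by blast
next
  assume "\<exists>x. x \<noteq> 0 \<and> X = vec.span {x}"
  then obtain x where x: "x \<noteq> 0" "X = vec.span {x}" by blast
  then have "vec.independent {x}" by (simp add: vec.dependent_single)
  then have "vec.dim X = 1" using x(2) vec.dim_eq_card_independent[of "{x}"] by simp
  then show "X \<in> pg_points" using x(2) unfolding pg_points_def by simp
qed

lemma card_three_span_add_neq:
  fixes x y :: "'f::field ^ 'n::finite"
  assumes F: "CARD('f) = 3" and "x \<noteq> 0" "y \<noteq> 0" "x \<noteq> y" "x \<noteq> -y"
  shows "vec.span {x + y} \<noteq> vec.span {x}"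
proof
  assume "vec.span {x + y} = vec.span {x}"
  then have "x + y \<in> {0, x, -x}"
    using vec.span_base[of "x + y" "{x + y}"] card_three_span_singleton[OF F, of x] by blast
  moreover have "y = x" if "x + y = -x"
  proof -
    have "y = (x + y) - x" by simp
    then have "y = -(x + x)" using that by simp
    then show ?thesis using card_three_vec_add_self[OF F, of x] by simp
  qed
  ultimately show False using assms by (auto simp: add_eq_0_iff2)
qed

text \<open>The eight nonzero combinations of \<open>u\<close> and \<open>v\<close> form four pairs
  of opposite vectors, and opposite vectors span the same point.\<close>

lemma card_three_line_points:
  fixes u v w :: "'f::field ^ 2"
  assumes F: "CARD('f) = 3" and uv: "vec.independent {u, v}" "u \<noteq> v" and w: "w \<noteq> 0"
  shows "vec.span {w} \<in> {vec.span {u}, vec.span {v}, vec.span {u + v}, vec.span {u - v}}"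
proof -
  have "vec.dim (UNIV :: ('f ^ 2) set) = 2"
    by (simp only: vec_dim_card) simp
  then have "w \<in> vec.span {u, v}"
    using vec.card_ge_dim_independent[OF subset_UNIV uv(1)] uv(2) by auto
  then obtain k where "w - k *s u \<in> vec.span {v}"
    using vec.span_breakdown_eq by blast
  then have "w - k *s u \<in> {0, v, -v}"
    using card_three_span_singleton[OF F] by metis
  moreover have "w = k *s u + (w - k *s u)" by simp
  ultimately obtain l where w_eq: "w = k *s u + l" and l: "l \<in> {0, v, -v}" by blast
  have "k *s u \<in> {0, u, -u}"
    by (cases k rule: card_three_cases[OF F]) auto
  then have "w \<in> {u, -u, v, -v, u + v, -(u + v), u - v, -(u - v)}"
    using w w_eq l by auto
  moreover have "vec.span {-x} = vec.span {x}" for x :: "'f ^ 2"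
    by (auto simp: card_three_span_singleton[OF F])
  ultimately show ?thesis by (metis insert_iff singletonD)
qed

text \<open>Generators of the two points of colour \<open>b\<close> form a basis of the plane; their
  sum and difference span points different from these two, hence of the other colour.\<close>

lemma balanced_colouring_basis:
  fixes c0 :: "('f::field ^ 2) set \<Rightarrow> bool"
  assumes F: "CARD('f) = 3" and c0: "card {X \<in> pg_points. c0 X = b} = 2"
  obtains u v where "vec.independent {u, v}" "u \<noteq> v"
    "c0 (vec.span {u}) = b" "c0 (vec.span {v}) = b"
    "c0 (vec.span {u + v}) = (\<not> b)" "c0 (vec.span {u - v}) = (\<not> b)"
proof -
  note span1 = card_three_span_singleton[OF F]
  obtain A B where AB: "{X \<in> pg_points. c0 X = b} = {A, B}" "A \<noteq> B"
    using c0 by (auto simp: card_2_iff)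
  then have "A \<in> pg_points" "B \<in> pg_points" and c: "c0 A = b" "c0 B = b" by auto
  then obtain u v where u: "u \<noteq> 0" "A = vec.span {u}" and v: "v \<noteq> 0" "B = vec.span {v}"
    unfolding pg_points_iff by blast
  have ne: "u \<noteq> v" "u \<noteq> -v" "v \<noteq> -u" using AB(2) u v by (auto simp: span1)
  have "vec.independent {u, v}"
    using u v ne by (simp add: vec.independent_insert vec.dependent_single span1)
  moreover have "c0 (vec.span {w}) = (\<not> b)"
    if "w \<noteq> 0" "vec.span {w} \<noteq> A" "vec.span {w} \<noteq> B" for w
    using AB(1) that pg_points_iff by blast
  moreover have "u + v \<noteq> 0" "u - v \<noteq> 0" using ne by (auto simp: add_eq_0_iff2)
  moreover have "vec.span {u + v} \<noteq> A" "vec.span {v + u} \<noteq> B" "vec.span {u + -v} \<noteq> A"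
    "vec.span {-v + u} \<noteq> vec.span {-v}"
    unfolding u(2) v(2) using u(1) v(1) ne
    by (intro card_three_span_add_neq[OF F]; auto)+
  moreover have "vec.span {-v} = B" using v by (auto simp: span1)
  ultimately show thesis
    using that[of u v] ne c u v by (simp add: add.commute)
qed

text \<open>If \<open>x\<close>, \<open>y\<close> violated the condition, the linear map taking a
  basis adapted to \<open>c0\<close> to \<open>x\<close>, \<open>y\<close> would embed
  \<open>c0\<close> in \<open>c\<close>.\<close>

lemma unsplit_of_pg_free:
  fixes c :: "('f::field ^ 'n::finite) set \<Rightarrow> bool"
  assumes F: "CARD('f) = 3" and c0: "\<forall>b. card {X \<in> pg_points. c0 X = b} = 2"
    and free: "pg_free c c0"
  shows "unsplit (\<lambda>x. c (vec.span {x}))"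
proof -
  note span1 = card_three_span_singleton[OF F]
  have "c (vec.span {-x}) = c (vec.span {x})" for x
    by (simp add: span1 insert_commute)
  moreover have "c (vec.span {x + y}) = c (vec.span {x})"
    if nz: "x \<noteq> 0" "y \<noteq> 0" "x \<noteq> y" "x \<noteq> -y" and P: "c (vec.span {x}) = c (vec.span {y})"
      "c (vec.span {x + y}) = c (vec.span {x - y})" for x y
  proof (rule ccontr)
    assume ne: "c (vec.span {x + y}) \<noteq> c (vec.span {x})"
    obtain u v where uv: "vec.independent {u, v}" "u \<noteq> v"
      and c0uv: "c0 (vec.span {u}) = c (vec.span {x})" "c0 (vec.span {v}) = c (vec.span {x})"
      "c0 (vec.span {u + v}) = (\<not> c (vec.span {x}))" "c0 (vec.span {u - v}) = (\<not> c (vec.span {x}))"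
      using balanced_colouring_basis[OF F c0[rule_format, of "c (vec.span {x})"]] by metis
    obtain g :: "'f ^ 2 \<Rightarrow> 'f ^ 'n" where g: "Vector_Spaces.linear (*s) (*s) g"
      and guv: "\<forall>z\<in>{u, v}. g z = (if z = u then x else y)"
      using vec.linear_independent_extend[OF uv(1), of "\<lambda>z. if z = u then x else y"] by blast
    have gs: "g u = x" "g v = y" "g (u + v) = x + y" "g (u - v) = x - y"
      using guv uv(2) vec.linear_add[OF g] vec.linear_diff[OF g] by auto
    have img: "g ` vec.span {w} = vec.span {g w}" for w
      using vec.linear_span_image[OF g, of "{w}"] by simp
    have "c (g ` X) = c0 X" if "X \<in> pg_points" for X
    proof -
      have "X \<in> {vec.span {u}, vec.span {v}, vec.span {u + v}, vec.span {u - v}}"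
        using that card_three_line_points[OF F uv] by (auto simp: pg_points_iff)
      then show ?thesis using img gs c0uv P ne by auto
    qed
    moreover have "inj g"
      unfolding vec.linear_inj_iff_eq_0[OF g]
    proof (intro allI impI, rule ccontr)
      \<comment> \<open>The image of the point of \<open>w\<close> would be \<open>{0}\<close>, yet
        it is one of the four points of the line through \<open>x\<close> and
        \<open>y\<close>.\<close>
      fix w assume w: "g w = 0" "w \<noteq> 0"
      have "vec.span {g w} \<in> {vec.span {x}, vec.span {y}, vec.span {x + y}, vec.span {x - y}}"
        using card_three_line_points[OF F uv w(2)] img gs by (metis insert_iff singletonD)
      then show False using w(1) nz by (auto simp: span1 add_eq_0_iff2)
    qed
    ultimately show False using free g unfolding pg_contains_def by blast
  qed
  ultimately show ?thesis unfolding unsplit_def by blast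
qed

text \<open>A copy of \<open>c0\<close> carries its adapted basis \<open>u\<close>, \<open>v\<close>
  to vectors that violate the condition of \<open>unsplit\<close>.\<close>

lemma pg_free_of_unsplit:
  fixes c :: "('f::field ^ 'n::finite) set \<Rightarrow> bool"
  assumes F: "CARD('f) = 3" and c0: "\<forall>b. card {X \<in> pg_points. c0 X = b} = 2"
    and c: "unsplit (\<lambda>x. c (vec.span {x}))"
  shows "pg_free c c0"
proof
  assume "pg_contains c c0"
  then obtain g :: "'f ^ 2 \<Rightarrow> 'f ^ 'n" where g: "Vector_Spaces.linear (*s) (*s) g" "inj g"
    and gc: "\<forall>X\<in>pg_points. c (g ` X) = c0 X"
    unfolding pg_contains_def by blast
  obtain u v where uv: "vec.independent {u, v}" "u \<noteq> v"
    and c0uv: "c0 (vec.span {u}) = True" "c0 (vec.span {v}) = True"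
    "c0 (vec.span {u + v}) = (\<not> True)" "c0 (vec.span {u - v}) = (\<not> True)"
    using balanced_colouring_basis[OF F c0[rule_format, of True]] by metis
  have cg: "c (vec.span {g w}) = c0 (vec.span {w})" if "w \<noteq> 0" for w
  proof -
    have "vec.span {w} \<in> pg_points" using that pg_points_iff by blast
    then show ?thesis
      using gc vec.linear_span_image[OF g(1), of "{w}"] by (metis image_insert image_empty)
  qed
  have uvnz: "u \<noteq> 0" "v \<noteq> 0" "v \<noteq> -u" "u \<noteq> -v"
    using uv by (auto simp: vec.independent_insert vec.dependent_single card_three_span_singleton[OF F])
  have inj: "g z = g w \<longleftrightarrow> z = w" for z w using g(2) by (auto dest: injD)
  have g0: "g 0 = 0" using vec.linear_0[OF g(1)] .
  have "c (vec.span {g u + g v}) = c (vec.span {g u})"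
  proof (rule unsplit_same[OF c])
    show "g u \<noteq> 0" "g v \<noteq> 0" using inj[of _ 0] g0 uvnz by auto
    show "g u \<noteq> g v" using inj uv(2) by blast
    show "g u \<noteq> - g v" using inj uvnz vec.linear_neg[OF g(1), of v] by metis
    show "c (vec.span {g u}) = c (vec.span {g v})" using cg uvnz c0uv by blast
    show "c (vec.span {g u + g v}) = c (vec.span {g u - g v})"
      using cg[of "u + v"] cg[of "u - v"] uvnz uv(2) c0uv
      by (auto simp: vec.linear_add[OF g(1)] vec.linear_diff[OF g(1)] add_eq_0_iff2)
  qed
  then show False
    using cg[of "u + v"] cg[of u] uvnz c0uv by (auto simp: vec.linear_add[OF g(1)] add_eq_0_iff2)
qed

section \<open>Sharpness: colouring by the parity of the leading position\<close>

text \<open>The index type carries no order, so \<open>f\<close> supplies the positions of the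
  coordinates. At the zero vector the value is unspecified.\<close>

definition lead :: "('n \<Rightarrow> nat) \<Rightarrow> 'f::field ^ 'n::finite \<Rightarrow> nat" where
  "lead f x = (LEAST k. \<exists>i. f i = k \<and> x $ i \<noteq> 0)"

lemma lead_eqI: "x $ i \<noteq> 0 \<Longrightarrow> (\<And>j. f j < f i \<Longrightarrow> x $ j = 0) \<Longrightarrow> lead f x = f i"
  unfolding lead_def by (intro Least_equality) (auto simp: not_less[symmetric])

lemma leadE:
  assumes "x \<noteq> 0"
  obtains i where "lead f x = f i" "x $ i \<noteq> 0" "\<And>j. f j < f i \<Longrightarrow> x $ j = 0"
proof -
  have "\<exists>k. \<exists>i. f i = k \<and> x $ i \<noteq> 0"
    using assms by (auto simp: vec_eq_iff)
  then obtain i where i: "f i = lead f x" "x $ i \<noteq> 0"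
    unfolding lead_def using LeastI_ex[of "\<lambda>k. \<exists>i. f i = k \<and> x $ i \<noteq> 0"] by blast
  moreover have "x $ j = 0" if "f j < f i" for j
    using that not_less_Least[of "f j" "\<lambda>k. \<exists>i. f i = k \<and> x $ i \<noteq> 0"] i(1)
    unfolding lead_def by auto
  ultimately show thesis using that by metis
qed

lemma lead_minus: "lead f (-x) = lead f x"
  unfolding lead_def by simp

text \<open>If the leading positions of \<open>x\<close> and \<open>y\<close> differ,
  \<open>x + y\<close> inherits the smaller one. If they agree, the leading entries cannot cancel in
  both \<open>x + y\<close> and \<open>x - y\<close>, as twice the entry of \<open>x\<close> is
  nonzero; so one of these keeps the position.\<close>

lemma unsplit_lead:
  fixes f :: "'n::finite \<Rightarrow> nat"
  assumes F: "CARD('f::field) = 3" and f: "inj f"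
  shows "unsplit (\<lambda>x :: 'f ^ 'n. even (lead f x))"
proof -
  have "even (lead f (x + y)) = even (lead f x)"
    if nz: "x \<noteq> 0" "y \<noteq> 0" and P: "even (lead f x) = even (lead f y)"
      "even (lead f (x + y)) = even (lead f (x - y))" for x y :: "'f ^ 'n"
  proof -
    obtain i where i: "lead f x = f i" "x $ i \<noteq> 0" "\<And>j. f j < f i \<Longrightarrow> x $ j = 0"
      using leadE[OF nz(1)] by metis
    obtain k where k: "lead f y = f k" "y $ k \<noteq> 0" "\<And>j. f j < f k \<Longrightarrow> y $ j = 0"
      using leadE[OF nz(2)] by metis
    consider "f i < f k" | "f k < f i" | "f i = f k" by linarith
    then show ?thesis
    proof cases
      case 1
      then have "lead f (x + y) = f i" using i k by (intro lead_eqI) auto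
      then show ?thesis using i by simp
    next
      case 2
      then have "lead f (x + y) = f k" using i k by (intro lead_eqI) auto
      then show ?thesis using k P by simp
    next
      case 3
      then have ik: "i = k" using f by (simp add: inj_eq)
      have "(x + y) $ i \<noteq> 0 \<or> (x - y) $ i \<noteq> 0"
      proof (rule ccontr)
        assume "\<not> ?thesis"
        then have "x $ i + x $ i = 0" by auto
        then show False using i(2) card_three_add_self[OF F, of "x $ i"] by simp
      qed
      then have "lead f (x + y) = f i \<or> lead f (x - y) = f i"
        using i k ik lead_eqI[of "x + y" i f] lead_eqI[of "x - y" i f] by auto
      then show ?thesis using i P by auto
    qed
  qed
  then show ?thesis unfolding unsplit_def lead_minus by blast
qed

lemma card_parity_le: "card {k. k < n \<and> even k = b} \<le> (n + 1) div 2"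
proof -
  have "inj_on (\<lambda>k. k div 2) {k. k < n \<and> even k = b}"
    by (rule inj_onI) (auto elim!: evenE oddE)
  moreover have "(\<lambda>k. k div 2) ` {k. k < n \<and> even k = b} \<subseteq> {..<(n + 1) div 2}"
    by auto
  ultimately show ?thesis
    using card_inj_on_le[of "\<lambda>k. k div 2" _ "{..<(n + 1) div 2}"] by simp
qed

text \<open>The projection \<open>g\<close> to the coordinates in \<open>E\<close> is injective on
  \<open>W\<close>, since it preserves the leading entry of every nonzero vector of
  \<open>W\<close>.\<close>

lemma dim_le_card_lead:
  fixes W :: "('f::field ^ 'n::finite) set"
  assumes W: "vec.subspace W" and lead: "\<And>x. x \<in> W \<Longrightarrow> x \<noteq> 0 \<Longrightarrow> lead f x \<in> f ` E"
    and f: "inj f"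
  shows "vec.dim W \<le> card E"
proof -
  define g :: "'f ^ 'n \<Rightarrow> 'f ^ 'n" where "g x = (\<chi> i. if i \<in> E then x $ i else 0)" for x
  have g: "Vector_Spaces.linear (*s) (*s) g"
    by unfold_locales (auto simp: g_def vec_eq_iff algebra_simps)
  have "x = 0" if "x \<in> W" "g x = 0" for x
  proof (rule ccontr)
    assume x: "x \<noteq> 0"
    obtain i where i: "lead f x = f i" "x $ i \<noteq> 0" using leadE[OF x] by metis
    then have "i \<in> E" using lead[OF that(1) x] f by (auto simp: inj_eq)
    then have "g x $ i \<noteq> 0" using i by (simp add: g_def)
    then show False using that(2) by simp
  qed
  then have "inj_on g W" using vec.linear_inj_on_iff_eq_0[OF g W] by blast
  then have "vec.dim W = vec.dim (g ` W)"
    using vec.dim_image_eq[OF g, of W] W vec.span_eq_iff by metis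
  also have "\<dots> \<le> card ((\<lambda>i. axis i (1::'f)) ` E)"
  proof (rule vec.dim_le_card)
    show "g ` W \<subseteq> vec.span ((\<lambda>i. axis i 1) ` E)"
    proof (rule image_subsetI)
      fix x
      have "g x = (\<Sum>i\<in>E. x $ i *s axis i 1)"
        by (auto simp: g_def vec_eq_iff axis_def if_distrib sum.delta cong: if_cong)
      also have "\<dots> \<in> vec.span ((\<lambda>i. axis i 1) ` E)"
        by (intro vec.span_sum vec.span_scale vec.span_base) auto
      finally show "g x \<in> vec.span ((\<lambda>i. axis i 1) ` E)" .
    qed
  qed simp
  also have "\<dots> \<le> card E" by (rule card_image_le) simp
  finally show ?thesis .
qed

lemma ceiling_half: "\<lceil>real n / 2\<rceil> = int ((n + 1) div 2)"
  by (cases "even n") (auto elim!: evenE oddE simp: ceiling_eq_iff add_divide_distrib)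

theorem theorem10p1:
  fixes c0 :: "('f::field ^ 2) set \<Rightarrow> bool"
  assumes "CARD('f) = 3"
    and "CARD('n::finite) \<ge> 2"
    and "\<forall>b. card {X \<in> pg_points. c0 X = b} = 2"
  shows "(\<forall>c :: ('f ^ 'n) set \<Rightarrow> bool. pg_free c c0 \<longrightarrow>
            (\<exists>S d. pg_subspace S d \<and> monochromatic c S \<and> int d \<ge> \<lceil>real CARD('n) / 2\<rceil>)) \<and>
         (\<exists>c :: ('f ^ 'n) set \<Rightarrow> bool. pg_free c c0 \<and>
            \<not> (\<exists>S d. pg_subspace S d \<and> monochromatic c S \<and> int d > \<lceil>real CARD('n) / 2\<rceil>))"
proof (intro conjI allI impI)
  fix c :: "('f ^ 'n) set \<Rightarrow> bool"
  assume "pg_free c c0"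
  then have "unsplit (\<lambda>x. c (vec.span {x}))"
    using unsplit_of_pg_free assms by blast
  from unsplit_monochromatic_subspaces[OF assms(1) this vec.subspace_UNIV]
  obtain W where W: "\<And>b. vec.subspace (W b)" "\<And>b x. x \<in> W b - {0} \<Longrightarrow> c (vec.span {x}) = b"
    and dim: "vec.dim (W True) + vec.dim (W False) = vec.dim (UNIV :: ('f ^ 'n) set)"
    by metis
  have "(CARD('n) + 1) div 2 \<le> vec.dim (W True) \<or> (CARD('n) + 1) div 2 \<le> vec.dim (W False)"
    using dim unfolding vec_dim_card by linarith
  then obtain b where b: "(CARD('n) + 1) div 2 \<le> vec.dim (W b)" by blast
  let ?S = "{X \<in> pg_points. X \<subseteq> W b}"
  have "pg_subspace ?S (vec.dim (W b))"
    unfolding pg_subspace_def using W(1) by blast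
  moreover have "c X = b" if X: "X \<in> ?S" for X
  proof -
    obtain x where x: "x \<noteq> 0" "X = vec.span {x}" using X pg_points_iff by blast
    then have "x \<in> W b" using X vec.span_base[of x "{x}"] by blast
    then show ?thesis using W(2)[of x b] x by blast
  qed
  then have "monochromatic c ?S" unfolding monochromatic_def by (intro exI[of _ b] ballI)
  ultimately show "\<exists>S d. pg_subspace S d \<and> monochromatic c S \<and> int d \<ge> \<lceil>real CARD('n) / 2\<rceil>"
    unfolding ceiling_half using b by (metis of_nat_le_iff)
next
  obtain f :: "'n \<Rightarrow> nat" where f: "bij_betw f UNIV {0..<CARD('n)}"
    using ex_bij_betw_finite_nat[of "UNIV :: 'n set"] by auto
  then have inj: "inj f" by (simp add: bij_betw_def)
  \<comment> \<open>The minimum runs over all vectors of the point, so no generator has to be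
    chosen: \<open>0\<close> contributes nothing, and \<open>x\<close> and \<open>-x\<close> have
    the same nonzero positions.\<close>
  define c :: "('f ^ 'n) set \<Rightarrow> bool"
    where "c X = even (LEAST k. \<exists>x\<in>X. \<exists>i. f i = k \<and> x $ i \<noteq> 0)" for X
  have c: "c (vec.span {x}) = even (lead f x)" for x
    unfolding c_def lead_def card_three_span_singleton[OF assms(1)] by simp
  have "pg_free c c0"
    using pg_free_of_unsplit[OF assms(1,3), of c] unsplit_lead[OF assms(1) inj] unfolding c by blast
  moreover have "\<not> int d > \<lceil>real CARD('n) / 2\<rceil>" if S: "pg_subspace S d" "monochromatic c S" for S d
  proof -
    obtain W where W: "vec.subspace W" "vec.dim W = d" "S = {X \<in> pg_points. X \<subseteq> W}"
      using S(1) unfolding pg_subspace_def by blast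
    obtain b where b: "\<forall>X\<in>S. c X = b" using S(2) unfolding monochromatic_def by blast
    define E where "E = {i. even (f i) = b}"
    have "lead f x \<in> f ` E" if x: "x \<in> W" "x \<noteq> 0" for x
    proof -
      have "vec.span {x} \<in> S"
        using x W vec.span_minimal[of "{x}" W] pg_points_iff by blast
      then have "even (lead f x) = b" using b c by metis
      moreover obtain i where "lead f x = f i" using leadE[OF x(2)] by metis
      ultimately show ?thesis unfolding E_def by auto
    qed
    then have "d \<le> card E" using dim_le_card_lead[OF W(1) _ inj] W(2) by blast
    also have "card E = card (f ` E)" using inj by (metis card_image inj_on_subset subset_UNIV)
    also have "\<dots> \<le> card {k. k < CARD('n) \<and> even k = b}"
      using f by (intro card_mono) (auto simp: E_def bij_betw_def)
    also have "\<dots> \<le> (CARD('n) + 1) div 2" by (rule card_parity_le)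
    finally show ?thesis unfolding ceiling_half by simp
  qed
  ultimately show "\<exists>c :: ('f ^ 'n) set \<Rightarrow> bool. pg_free c c0 \<and>
      \<not> (\<exists>S d. pg_subspace S d \<and> monochromatic c S \<and> int d > \<lceil>real CARD('n) / 2\<rceil>)"
    by blast
qed

end
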